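(* Let $\mathcal{X}$, $\mathcal{Y}$ be Polish spaces and let $\psi:\mathcal{Y}\to\mathcal{X}$ be a Borel measurable mapping. Let $\eta\in\mathcal{P}(\mathcal{X})$, $\gamma_0\in\mathcal{P}(\mathcal{Y})$. Then $$R\bigl(\eta\,\|\,\psi(\gamma_0)\bigr)=\inf_{\gamma\in\mathcal{P}(\mathcal{Y}):\,\psi(\gamma)=\eta}R(\gamma\|\gamma_0),$$ where $\inf\varnothing=\infty$ by convention.
   Context: $\mathcal{P}(\mathcal{S})$ is the set of Borel probability measures on a Polish space $\mathcal{S}$. For $\gamma\in\mathcal{P}(\mathcal{Y})$, $\psi(\gamma)=\gamma\circ\psi^{-1}$ is the image measure of $\gamma$ under $\psi$. The relative entropy is $R(\nu\|\mu)=\int\log\bigl(\frac{d\nu}{d\mu}\bigr)d\nu\in[0,\infty]$ if $\nu$ is absolutely continuous with respect to $\mu$, and $R(\nu\|\mu)=\infty$ otherwise. *)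

theory Defs
  imports "HOL-Probability.Probability"
begin

abbreviation borel_prob_measures :: "'a::topological_space measure set" where
  "borel_prob_measures \<equiv> space (prob_algebra borel)"

text \<open>
  The integral of the logarithm of the density is taken in the extended sense, as the integral of
  the positive part minus that of the negative part. (The library's \<open>KL_divergence\<close> is
  real-valued and is 0 where the integral diverges.) For probability measures with
  \<open>\<nu> \<lless> \<mu>\<close> the integral of the negative part is finite, as
  \<open>- t * ln t \<le> exp (- 1)\<close>. The points where the density is 0 or \<open>\<infinity>\<close>,
  at which the integrand below has the junk value 0, form a \<open>\<nu>\<close>-null set.
\<close>

definition relative_entropy :: "'a measure \<Rightarrow> 'a measure \<Rightarrow> ereal" where
  "relative_entropy \<nu> \<mu> =
    (if absolutely_continuous \<mu> \<nu>
     then enn2ereal (\<integral>\<^sup>+ x. ennreal (ln (enn2real (RN_deriv \<mu> \<nu> x))) \<partial>\<nu>)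
        - enn2ereal (\<integral>\<^sup>+ x. ennreal (- ln (enn2real (RN_deriv \<mu> \<nu> x))) \<partial>\<nu>)
     else \<infinity>)"

end

theory Submission
  imports Defs
begin

text \<open>
  Write \<open>\<mu> = \<psi>(\<gamma>\<^sub>0)\<close>. If \<open>\<eta> \<lless> \<mu>\<close> with density \<open>g\<close>, then the measure
  with density \<open>g \<circ> \<psi>\<close> with respect to \<open>\<gamma>\<^sub>0\<close> is mapped to \<open>\<eta>\<close> by \<open>\<psi>\<close>, and a change of
  variables shows that its entropy relative to \<open>\<gamma>\<^sub>0\<close> is exactly \<open>R(\<eta> \<parallel> \<mu>)\<close>
  (lemma \<open>relative_entropy_density_comp\<close>). So the infimum is at most the left-hand side,
  which is infinite if \<open>\<eta> \<lless> \<mu>\<close> fails.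

  Conversely, no \<open>\<gamma>\<close> with \<open>\<psi>(\<gamma>) = \<eta>\<close> does better: this is the data processing inequality
  (lemma \<open>relative_entropy_distr_le\<close>). One may assume \<open>\<gamma> \<lless> \<gamma>\<^sub>0\<close>, which implies
  \<open>\<eta> \<lless> \<mu>\<close>. With \<open>h = g \<circ> \<psi>\<close>,
  the integral of \<open>ln h\<close> with respect to \<open>\<gamma>\<close> is the integral of \<open>ln g\<close> with respect
  to \<open>\<eta>\<close>, which is \<open>R(\<eta> \<parallel> \<mu>)\<close>. And as \<open>h\<close> is a probability density with respect to \<open>\<gamma>\<^sub>0\<close>,
  the integral of \<open>ln h\<close> with respect to \<open>\<gamma>\<close> is at most \<open>R(\<gamma> \<parallel> \<gamma>\<^sub>0)\<close>
  (lemma \<open>relative_entropy_ge_log_density\<close>): integrate the pointwise bound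
  \<open>f * ln h + f \<le> f * ln f + h\<close>, where \<open>f\<close> is the density of \<open>\<gamma>\<close>.

  The logarithms need not be integrable. All estimates are therefore made between nonnegative
  integrals of positive and negative parts, and only the negative parts, which always have
  finite integrals, are subtracted at the end.
\<close>

definition log_integral :: "'a measure \<Rightarrow> ('a \<Rightarrow> ennreal) \<Rightarrow> ereal" where
  "log_integral N f =
    enn2ereal (\<integral>\<^sup>+ x. ennreal (ln (enn2real (f x))) \<partial>N) -
    enn2ereal (\<integral>\<^sup>+ x. ennreal (- ln (enn2real (f x))) \<partial>N)"

lemma log_integral_cong_AE:
  assumes "AE x in N. f x = g x"
  shows "log_integral N f = log_integral N g"
proof -
  have "(\<integral>\<^sup>+ x. ennreal (ln (enn2real (f x))) \<partial>N) = (\<integral>\<^sup>+ x. ennreal (ln (enn2real (g x))) \<partial>N)"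
    by (rule nn_integral_cong_AE) (use assms in auto)
  moreover have "(\<integral>\<^sup>+ x. ennreal (- ln (enn2real (f x))) \<partial>N) =
      (\<integral>\<^sup>+ x. ennreal (- ln (enn2real (g x))) \<partial>N)"
    by (rule nn_integral_cong_AE) (use assms in auto)
  ultimately show ?thesis
    by (simp add: log_integral_def)
qed

lemma log_integral_distr:
  assumes [measurable]: "T \<in> measurable N X" "g \<in> borel_measurable X"
  shows "log_integral (distr N X T) g = log_integral N (\<lambda>x. g (T x))"
  by (simp add: log_integral_def nn_integral_distr)

lemma relative_entropy_density:
  assumes "sigma_finite_measure M" and [measurable]: "f \<in> borel_measurable M"
  shows "relative_entropy (density M f) M = log_integral (density M f) f"
proof -
  interpret sigma_finite_measure M by fact
  have ac: "absolutely_continuous M (density M f)"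
    by (rule absolutely_continuousI_density) simp
  have "AE x in M. f x = RN_deriv M (density M f) x"
    by (rule RN_deriv_unique) auto
  then have "AE x in density M f. RN_deriv M (density M f) x = f x"
    by (auto simp: AE_density)
  from log_integral_cong_AE[OF this] show ?thesis
    using ac by (simp add: relative_entropy_def log_integral_def)
qed

lemma density_of_absolutely_continuous:
  assumes "prob_space M" "prob_space N" "sets N = sets M" "absolutely_continuous M N"
  obtains f where "f \<in> borel_measurable M" "N = density M f"
    "integral\<^sup>N M f = 1" "AE x in M. f x \<noteq> \<infinity>" "AE x in N. f x \<noteq> 0"
proof
  interpret M: prob_space M by fact
  interpret N: prob_space N by fact
  let ?f = "RN_deriv M N"
  show f: "?f \<in> borel_measurable M" by simp
  show N: "N = density M ?f"
    using M.density_RN_deriv[OF assms(4,3)] by simp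
  have "emeasure N (space N) = integral\<^sup>N M ?f"
    using f by (subst N, subst emeasure_density) (auto simp: sets_eq_imp_space_eq[OF assms(3)]
      intro!: nn_integral_cong)
  then show I: "integral\<^sup>N M ?f = 1"
    by (simp add: N.emeasure_space_1)
  show "AE x in M. ?f x \<noteq> \<infinity>"
    by (rule nn_integral_PInf_AE) (use I in auto)
  have "AE x in density M ?f. ?f x \<noteq> 0"
    by (auto simp: AE_density)
  then show "AE x in N. ?f x \<noteq> 0"
    unfolding M.density_RN_deriv[OF assms(4,3)] .
qed

text \<open>
  The inequality \<open>a * ln b + a \<le> a * ln a + b\<close>, that is \<open>ln (b / a) \<le> b / a - 1\<close>, with the
  positive and negative parts of the logarithms arranged so that no subtraction occurs.
\<close>

lemma log_tangent_ennreal: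
  fixes f h :: ennreal
  assumes "f \<noteq> \<infinity>" "f \<noteq> 0 \<Longrightarrow> h \<noteq> 0 \<and> h \<noteq> \<infinity>"
  shows "f * ennreal (ln (enn2real h)) + f * ennreal (- ln (enn2real f)) + f \<le>
    f * ennreal (ln (enn2real f)) + f * ennreal (- ln (enn2real h)) + h"
proof (cases "f = 0")
  case False
  obtain a where a: "f = ennreal a" "a > 0"
    using assms(1) False by (cases f) (auto simp: less_le)
  obtain b where b: "h = ennreal b" "b > 0"
    using assms(2) False by (cases h) (auto simp: less_le)
  have e: "ennreal x = ennreal (max 0 x)" for x
    by (simp add: max_def ennreal_neg)
  have "ln (b / a) \<le> b / a - 1"
    using a b by (intro ln_le_minus_one) auto
  then have "a * (ln b - ln a) \<le> a * (b / a - 1)"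
    using a b by (intro mult_left_mono) (auto simp: ln_div)
  moreover have "a * (b / a - 1) = b - a"
    using a by (simp add: right_diff_distrib)
  ultimately have main: "a * ln b + a \<le> a * ln a + b"
    by (simp add: algebra_simps)
  have mx: "max 0 y = y + max 0 (- y)" for y :: real
    by (simp add: max_def)
  have "a * max 0 (ln b) + a * max 0 (- ln a) + a \<le> a * max 0 (ln a) + a * max 0 (- ln b) + b"
    using main by (subst mx[of "ln b"], subst mx[of "ln a"]) (simp add: algebra_simps)
  then have "ennreal (a * max 0 (ln b) + a * max 0 (- ln a) + a) \<le>
      ennreal (a * max 0 (ln a) + a * max 0 (- ln b) + b)"
    by (rule ennreal_leI)
  moreover have "f * ennreal x = ennreal (a * max 0 x)" for x
    using a by (subst e) (simp add: ennreal_mult')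
  ultimately show ?thesis
    using a b by simp
qed simp

text \<open>
  The integrand with respect to \<open>M\<close> is the positive part of \<open>- t * ln t\<close>, and
  \<open>- ln t = ln (1 / t) \<le> 1 / t\<close>.
\<close>

lemma nn_integral_neg_log_density_le_1:
  assumes "prob_space M" and [measurable]: "f \<in> borel_measurable M"
  shows "(\<integral>\<^sup>+ x. ennreal (- ln (enn2real (f x))) \<partial>density M f) \<le> 1"
proof -
  interpret prob_space M by fact
  have bound: "y * ennreal (- ln (enn2real y)) \<le> 1" for y :: ennreal
  proof (cases "y = 0 \<or> y = \<infinity>")
    case False
    then obtain a where a: "y = ennreal a" "a > 0"
      by (cases y) (auto simp: less_le)
    have "ln (1 / a) \<le> 1 / a - 1"
      using a by (intro ln_le_minus_one) auto
    then have "a * (- ln a) \<le> a * (1 / a)"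
      using a by (intro mult_left_mono) (auto simp: ln_div)
    then have "ennreal (a * (- ln a)) \<le> 1"
      using a by (simp add: ennreal_le_1)
    then show ?thesis
      using a by (simp add: ennreal_mult'[symmetric])
  qed auto
  have "(\<integral>\<^sup>+ x. ennreal (- ln (enn2real (f x))) \<partial>density M f) =
      (\<integral>\<^sup>+ x. f x * ennreal (- ln (enn2real (f x))) \<partial>M)"
    by (subst nn_integral_density) auto
  also have "\<dots> \<le> (\<integral>\<^sup>+ x. 1 \<partial>M)"
    by (intro nn_integral_mono bound)
  finally show ?thesis
    by (simp add: emeasure_space_1)
qed

text \<open>
  For \<open>h\<close> with integral 1 the difference of the two sides is the entropy of \<open>N\<close> relative to
  the measure with density \<open>h\<close>, so this is the nonnegativity of relative entropy, in a form
  that makes sense when both sides are infinite.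
\<close>

lemma relative_entropy_ge_log_density:
  assumes M: "prob_space M" and N: "prob_space N" "sets N = sets M"
    and h [measurable]: "h \<in> borel_measurable M" and h1: "integral\<^sup>N M h \<le> 1"
    and pos: "AE x in N. h x \<noteq> 0"
    and fin: "(\<integral>\<^sup>+ x. ennreal (- ln (enn2real (h x))) \<partial>N) \<noteq> \<infinity>"
  shows "log_integral N h \<le> relative_entropy N M"
proof (cases "absolutely_continuous M N")
  case True
  interpret prob_space M by fact
  obtain f where f [measurable]: "f \<in> borel_measurable M" and Nf: "N = density M f"
    and f1: "integral\<^sup>N M f = 1" and ff: "AE x in M. f x \<noteq> \<infinity>"
    by (rule density_of_absolutely_continuous[OF M N True])
  define Fp Fn Hp Hn where
    "Fp = (\<integral>\<^sup>+ x. ennreal (ln (enn2real (f x))) \<partial>N)" and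
    "Fn = (\<integral>\<^sup>+ x. ennreal (- ln (enn2real (f x))) \<partial>N)" and
    "Hp = (\<integral>\<^sup>+ x. ennreal (ln (enn2real (h x))) \<partial>N)" and
    "Hn = (\<integral>\<^sup>+ x. ennreal (- ln (enn2real (h x))) \<partial>N)"
  note defs = this
  \<comment> \<open>The tangent bound requires \<open>h\<close> to be finite and to vanish only where \<open>f\<close> does.\<close>
  have hf: "AE x in M. h x \<noteq> \<infinity>"
    by (rule nn_integral_PInf_AE) (use h1 in \<open>auto simp: top_unique\<close>)
  have "AE x in M. 0 < f x \<longrightarrow> h x \<noteq> 0"
    using pos unfolding Nf by (subst (asm) AE_density) auto
  then have "AE x in M.
      f x * ennreal (ln (enn2real (h x))) + f x * ennreal (- ln (enn2real (f x))) + f x \<le>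
      f x * ennreal (ln (enn2real (f x))) + f x * ennreal (- ln (enn2real (h x))) + h x"
    using ff hf
  proof eventually_elim
    case (elim x)
    then show ?case
      by (intro log_tangent_ennreal) (auto simp: zero_less_iff_neq_zero)
  qed
  then have "(\<integral>\<^sup>+ x. f x * ennreal (ln (enn2real (h x))) +
        f x * ennreal (- ln (enn2real (f x))) + f x \<partial>M) \<le>
      (\<integral>\<^sup>+ x. f x * ennreal (ln (enn2real (f x))) +
        f x * ennreal (- ln (enn2real (h x))) + h x \<partial>M)"
    by (rule nn_integral_mono_AE)
  then have "Hp + Fn + integral\<^sup>N M f \<le> Fp + Hn + integral\<^sup>N M h"
    unfolding defs Nf by (simp add: nn_integral_add nn_integral_density)
  also have "\<dots> \<le> Fp + Hn + 1"
    by (intro add_left_mono h1)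
  finally have le: "Hp + Fn \<le> Fp + Hn"
    using f1 ennreal_add_left_cancel_le[of 1 "Hp + Fn" "Fp + Hn"] by (simp add: ac_simps)
  have "Fn \<le> 1"
    unfolding defs Nf by (rule nn_integral_neg_log_density_le_1) (use M in auto)
  then obtain u where u: "Fn = ennreal u" "0 \<le> u"
    by (cases Fn) (auto simp: top_unique)
  obtain v where v: "Hn = ennreal v" "0 \<le> v"
    using fin unfolding defs by (cases "\<integral>\<^sup>+ x. ennreal (- ln (enn2real (h x))) \<partial>N") auto
  have "enn2ereal Hp - enn2ereal Hn \<le> enn2ereal Fp - enn2ereal Fn"
  proof (cases "Fp = \<infinity>")
    case False
    then obtain p where p: "Fp = ennreal p" "0 \<le> p"
      by (cases Fp) auto
    from le obtain q where q: "Hp = ennreal q" "0 \<le> q"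
      using u v p by (cases Hp) (auto simp: top_unique simp flip: ennreal_plus)
    from le have "q + u \<le> p + v"
      using u v p q by (simp flip: ennreal_plus)
    then show ?thesis
      using u v p q by (simp add: enn2ereal_ennreal)
  qed (use u in \<open>simp add: enn2ereal_ennreal\<close>)
  also have "\<dots> = relative_entropy N M"
    unfolding Nf by (subst relative_entropy_density)
      (auto simp: log_integral_def defs Nf sigma_finite_measure_axioms)
  finally show ?thesis
    by (simp add: log_integral_def defs)
qed (simp add: relative_entropy_def)

text \<open>
  A density that factors through \<open>T\<close> loses no entropy under \<open>T\<close>.
\<close>

lemma relative_entropy_density_comp:
  assumes M: "prob_space M" and [measurable]: "T \<in> measurable M X" "g \<in> borel_measurable X"
  shows "relative_entropy (density M (\<lambda>x. g (T x))) M =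
    relative_entropy (density (distr M X T) g) (distr M X T)"
proof -
  interpret prob_space M by fact
  interpret D: prob_space "distr M X T" by (rule prob_space_distr) simp
  have "relative_entropy (density (distr M X T) g) (distr M X T) =
      log_integral (density (distr M X T) g) g"
    by (rule relative_entropy_density) (auto intro: D.sigma_finite_measure_axioms)
  also have "\<dots> = log_integral (density M (\<lambda>x. g (T x))) (\<lambda>x. g (T x))"
    by (subst density_distr) (auto intro!: log_integral_distr)
  also have "\<dots> = relative_entropy (density M (\<lambda>x. g (T x))) M"
    by (rule relative_entropy_density[symmetric]) (auto intro: sigma_finite_measure_axioms)
  finally show ?thesis ..
qed

lemma absolutely_continuous_distr:
  assumes "absolutely_continuous M N" "sets N = sets M" "T \<in> measurable M X"
  shows "absolutely_continuous (distr M X T) (distr N X T)"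
proof -
  have T: "T \<in> measurable N X"
    using assms(2,3) by (simp cong: measurable_cong_sets)
  show ?thesis
    using assms(1) sets_eq_imp_space_eq[OF assms(2)]
    unfolding absolutely_continuous_def
    by (auto simp: null_sets_distr_iff[OF T] null_sets_distr_iff[OF assms(3)])
qed

lemma relative_entropy_distr_le:
  assumes M: "prob_space M" and N: "prob_space N" "sets N = sets M"
    and T [measurable]: "T \<in> measurable M X"
  shows "relative_entropy (distr N X T) (distr M X T) \<le> relative_entropy N M"
proof (cases "absolutely_continuous M N")
  case True
  interpret M: prob_space M by fact
  interpret N: prob_space N by fact
  have TN [measurable]: "T \<in> measurable N X"
    using T N(2) by (simp cong: measurable_cong_sets)
  let ?D = "distr M X T" and ?E = "distr N X T"
  have D: "prob_space ?D" and E: "prob_space ?E"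
    by (auto intro: M.prob_space_distr N.prob_space_distr)
  interpret D: prob_space ?D by fact
  have "sets ?E = sets ?D"
    by simp
  then obtain g where g: "g \<in> borel_measurable ?D" and Eg: "?E = density ?D g"
    and g1: "integral\<^sup>N ?D g = 1" and g0: "AE x in ?E. g x \<noteq> 0"
    using absolutely_continuous_distr[OF True N(2) T]
    by (rule density_of_absolutely_continuous[OF D E])
  have [measurable]: "g \<in> borel_measurable X"
    using g by simp
  have "relative_entropy ?E ?D = log_integral ?E g"
    unfolding Eg by (rule relative_entropy_density) (use g in \<open>auto intro: D.sigma_finite_measure_axioms\<close>)
  also have "\<dots> = log_integral N (\<lambda>x. g (T x))"
    by (rule log_integral_distr) auto
  also have "\<dots> \<le> relative_entropy N M"
  proof (rule relative_entropy_ge_log_density[OF M N])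
    show "(\<lambda>x. g (T x)) \<in> borel_measurable M"
      by simp
    show "(\<integral>\<^sup>+ x. g (T x) \<partial>M) \<le> 1"
      using g1 by (simp add: nn_integral_distr)
    show "AE x in N. g (T x) \<noteq> 0"
      using g0 by (subst (asm) AE_distr_iff) auto
    have "(\<integral>\<^sup>+ x. ennreal (- ln (enn2real (g (T x)))) \<partial>N) =
        (\<integral>\<^sup>+ x. ennreal (- ln (enn2real (g x))) \<partial>?E)"
      by (simp add: nn_integral_distr)
    also have "\<dots> \<le> 1"
      unfolding Eg by (rule nn_integral_neg_log_density_le_1[OF D g])
    finally show "(\<integral>\<^sup>+ x. ennreal (- ln (enn2real (g (T x)))) \<partial>N) \<noteq> \<infinity>"
      by (auto simp: top_unique)
  qed
  finally show ?thesis .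
qed (simp add: relative_entropy_def)

theorem lemmaA1:
  fixes \<psi> :: "'y::polish_space \<Rightarrow> 'x::polish_space"
    and \<eta> :: "'x measure"
    and \<gamma>\<^sub>0 :: "'y measure"
  assumes "\<psi> \<in> borel_measurable borel"
    and "\<eta> \<in> borel_prob_measures"
    and "\<gamma>\<^sub>0 \<in> borel_prob_measures"
  shows "relative_entropy \<eta> (distr \<gamma>\<^sub>0 borel \<psi>) =
    (INF \<gamma> \<in> {\<gamma> \<in> borel_prob_measures. distr \<gamma> borel \<psi> = \<eta>}. relative_entropy \<gamma> \<gamma>\<^sub>0)"
proof (rule antisym)
  have g0: "prob_space \<gamma>\<^sub>0" "sets \<gamma>\<^sub>0 = sets borel"
    and eta: "prob_space \<eta>" "sets \<eta> = sets borel"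
    using assms by (auto simp: space_prob_algebra)
  interpret g0: prob_space \<gamma>\<^sub>0 by fact
  have psi [measurable]: "\<psi> \<in> measurable \<gamma>\<^sub>0 borel"
    using assms(1) g0(2) by (simp cong: measurable_cong_sets)
  let ?D = "distr \<gamma>\<^sub>0 borel \<psi>"
  show "relative_entropy \<eta> ?D \<le>
      (INF \<gamma> \<in> {\<gamma> \<in> borel_prob_measures. distr \<gamma> borel \<psi> = \<eta>}. relative_entropy \<gamma> \<gamma>\<^sub>0)"
    using g0 psi
    by (intro INF_greatest) (auto simp: space_prob_algebra intro!: relative_entropy_distr_le)
  show "(INF \<gamma> \<in> {\<gamma> \<in> borel_prob_measures. distr \<gamma> borel \<psi> = \<eta>}. relative_entropy \<gamma> \<gamma>\<^sub>0) \<le>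
      relative_entropy \<eta> ?D"
  proof (cases "absolutely_continuous ?D \<eta>")
    case True
    have D: "prob_space ?D"
      by (rule g0.prob_space_distr) simp
    have "sets \<eta> = sets ?D"
      using eta by simp
    then obtain g where g: "g \<in> borel_measurable ?D" and eg: "\<eta> = density ?D g"
      using True by (rule density_of_absolutely_continuous[OF D eta(1)])
    have [measurable]: "g \<in> borel_measurable borel"
      using g by simp
    let ?G = "density \<gamma>\<^sub>0 (\<lambda>x. g (\<psi> x))"
    have "distr ?G borel \<psi> = \<eta>"
      unfolding eg by (rule density_distr[symmetric]) auto
    moreover from this have "prob_space ?G"
      using eta(1) by (intro prob_space_distrD[of \<psi> ?G borel]) auto
    ultimately have "?G \<in> {\<gamma> \<in> borel_prob_measures. distr \<gamma> borel \<psi> = \<eta>}"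
      using g0(2) by (auto simp: space_prob_algebra)
    then have "(INF \<gamma> \<in> {\<gamma> \<in> borel_prob_measures. distr \<gamma> borel \<psi> = \<eta>}. relative_entropy \<gamma> \<gamma>\<^sub>0)
        \<le> relative_entropy ?G \<gamma>\<^sub>0"
      by (rule INF_lower)
    also have "\<dots> = relative_entropy \<eta> ?D"
      unfolding eg by (rule relative_entropy_density_comp[OF g0(1)]) auto
    finally show ?thesis .
  qed (simp add: relative_entropy_def)
qed

end
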